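(* Let $0<U_0<U_1<U_2$ and $0<\varepsilon<\hbar\omega_D$ be real constants with $\varepsilon$ small enough that $U_0\log(\hbar\omega_D/\varepsilon)>1$. Let $U(\cdot,\cdot)\in C([\varepsilon,\hbar\omega_D]^2)$ satisfy $U_1\le U(x,\xi)\le U_2$ at all $(x,\xi)\in[\varepsilon,\hbar\omega_D]^2$. Let $\tau_k$, $\Delta_k$, $\Delta_k^{-1}$ ($k=0,1,2$) be as defined in the context, and let $T_1$ satisfy $0<T_1<\Delta_0^{-1}(\Delta_0(0)/2)$ and $$\frac{\Delta_0(0)}{4\Delta_2^{-1}(\Delta_0(T_1))} \tanh \frac{\Delta_0(0)}{4\Delta_2^{-1}(\Delta_0(T_1))} > \frac{1}{2}\left(1 + \frac{4\hbar^2\omega_D^2}{\Delta_0(0)^2}\right).$$ For each $T\in[0,T_1]$ let $u_0(T,\cdot)$ be the unique continuous function on $[\varepsilon,\hbar\omega_D]$ with $\Delta_1(T)\le u_0(T,x)\le\Delta_2(T)$ for all $x\in[\varepsilon,\hbar\omega_D]$ that solves the BCS gap equation $$u_0(T, x) = \int_\varepsilon^{\hbar\omega_D} \frac{U(x, \xi)\, u_0(T, \xi)}{\sqrt{\xi^2 + u_0(T, \xi)^2}} \tanh \frac{\sqrt{\xi^2 + u_0(T, \xi)^2}}{2T}\, d\xi, \qquad x\in[\varepsilon,\hbar\omega_D].$$ Let $$V = \{u \in C([0, T_1] \times [\varepsilon, \hbar\omega_D]) : \Delta_1(T) \leq u(T,x) \leq \Delta_2(T) \text{ at } (T,x) \in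 [0, T_1] \times [\varepsilon, \hbar\omega_D]\}.$$ Then $u_0\in V$. Consequently, the gap function $u_0$ is continuous on $[0,T_1]\times[\varepsilon,\hbar\omega_D]$.
   Context: Here $\hbar\omega_D>0$ is treated as a single positive real constant (so $\hbar^2\omega_D^2=(\hbar\omega_D)^2$), and $T\ge 0$ is the absolute temperature. At $T=0$ every factor $\tanh\frac{(\cdot)}{2T}$ is understood as its limit as $T\downarrow 0$, i.e. as $1$. For $k=0,1,2$, the number $\tau_k>0$ is defined by $$1 = U_k \int_\varepsilon^{\hbar\omega_D} \frac{1}{\xi} \tanh \frac{\xi}{2\tau_k}\, d\xi,$$ and $\Delta_k:[0,\tau_k]\to[0,\infty)$ is the unique nonnegative solution to the simple gap equation $$1 = U_k \int_\varepsilon^{\hbar\omega_D} \frac{1}{\sqrt{\xi^2 + \Delta_k(T)^2}} \tanh \frac{\sqrt{\xi^2 + \Delta_k(T)^2}}{2T}\, d\xi,\qquad 0\le T\le\tau_k.$$ It is continuous and strictly decreasing with $\Delta_k(\tau_k)=0$ and $$\Delta_k(0) = \frac{\sqrt{(\hbar\omega_D - \varepsilon e^{1/U_k})(\hbar\omega_D - \varepsilon e^{-1/U_k})}}{\sinh(1/U_k)}.$$ One sets $\Delta_k(T)=0$ for $T>\tau_k$. The inverse of $\Delta_k$ on $[0,\tau_k]$ is denoted $\Delta_k^{-1}:[0,\Delta_k(0)]\to[0,\tau_k]$. One has $\tau_0<\tau_1<\tau_2$, $\Delta_0(0)<\Delta_1(0)<\Delta_2(0)$, and $0<\Delta_0(T)<\Delta_1(T)<\Delta_2(T)$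 for $0\le T<\tau_0$; in particular $T_1<\tau_0$. $C([0,T_1]\times[\varepsilon,\hbar\omega_D])$ is the Banach space of real functions $u(T,x)$ that are continuous jointly in $(T,x)$. The existence and uniqueness of $u_0(T,\cdot)$ for each fixed $T\in[0,T_1]$ is part of the setting. *)

theory Defs
  imports "HOL-Analysis.Analysis" "HOL-Real_Asymp.Real_Asymp"
begin

text \<open>
  Throughout, \<open>\<omega>\<close> stands for the single positive constant \<open>\<hbar>\<omega>\<^sub>D\<close>. A function of
  \<open>(T, x)\<close> is a curried function on all of the reals; only its values on the stated domain are
  constrained.
\<close>

definition thermal :: "real \<Rightarrow> real \<Rightarrow> real" where
  "thermal T E = (if T = 0 then 1 else tanh (E / (2 * T)))"

text \<open>The value at \<open>T = 0\<close> is the limit \<open>T \<down> 0\<close> at the energies \<open>E > 0\<close> that occur below.\<close>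

lemma thermal_tendsto_0:
  assumes "E > 0"
  shows "((\<lambda>T. thermal T E) \<longlongrightarrow> thermal 0 E) (at_right 0)"
proof -
  have "filterlim (\<lambda>T::real. E / (2 * T)) at_top (at_right 0)"
    using assms by real_asymp
  then have "((\<lambda>T. tanh (E / (2 * T))) \<longlongrightarrow> 1) (at_right 0)"
    by (rule filterlim_compose[OF tanh_real_at_top])
  moreover have "\<forall>\<^sub>F T in at_right 0. tanh (E / (2 * T)) = thermal T E"
    by (auto simp: eventually_at_filter thermal_def)
  ultimately show ?thesis
    by (simp add: tendsto_cong thermal_def)
qed

definition crit_temp :: "real \<Rightarrow> real \<Rightarrow> real \<Rightarrow> real" where
  "crit_temp \<epsilon> \<omega> c =
     (THE t. t > 0 \<and> 1 = c * integral {\<epsilon>..\<omega>} (\<lambda>\<xi>. 1 / \<xi> * tanh (\<xi> / (2 * t))))"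

text \<open>
  \<open>simple_gap \<epsilon> \<omega> U\<^sub>k\<close> is \<open>\<Delta>\<^sub>k\<close>, extended by zero above \<open>\<tau>\<^sub>k = crit_temp \<epsilon> \<omega> U\<^sub>k\<close>; its values at
  negative temperatures are irrelevant.
\<close>

definition simple_gap :: "real \<Rightarrow> real \<Rightarrow> real \<Rightarrow> real \<Rightarrow> real" where
  "simple_gap \<epsilon> \<omega> c T =
     (if T \<le> crit_temp \<epsilon> \<omega> c
      then THE d. d \<ge> 0 \<and>
        1 = c * integral {\<epsilon>..\<omega>}
          (\<lambda>\<xi>. 1 / sqrt (\<xi>\<^sup>2 + d\<^sup>2) * thermal T (sqrt (\<xi>\<^sup>2 + d\<^sup>2)))
      else 0)"

definition simple_gap_inv :: "real \<Rightarrow> real \<Rightarrow> real \<Rightarrow> real \<Rightarrow> real" where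
  "simple_gap_inv \<epsilon> \<omega> c = the_inv_into {0..crit_temp \<epsilon> \<omega> c} (simple_gap \<epsilon> \<omega> c)"

definition BCS_gap_solution ::
  "real \<Rightarrow> real \<Rightarrow> real \<Rightarrow> real \<Rightarrow> (real \<Rightarrow> real \<Rightarrow> real) \<Rightarrow> real \<Rightarrow> (real \<Rightarrow> real) \<Rightarrow> bool" where
  "BCS_gap_solution \<epsilon> \<omega> U1 U2 U T v \<longleftrightarrow>
     continuous_on {\<epsilon>..\<omega>} v \<and>
     (\<forall>x\<in>{\<epsilon>..\<omega>}. simple_gap \<epsilon> \<omega> U1 T \<le> v x \<and> v x \<le> simple_gap \<epsilon> \<omega> U2 T) \<and>
     (\<forall>x\<in>{\<epsilon>..\<omega>}. v x = integral {\<epsilon>..\<omega>}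
        (\<lambda>\<xi>. U x \<xi> * v \<xi> / sqrt (\<xi>\<^sup>2 + (v \<xi>)\<^sup>2) * thermal T (sqrt (\<xi>\<^sup>2 + (v \<xi>)\<^sup>2))))"

definition gap_function_space ::
  "real \<Rightarrow> real \<Rightarrow> real \<Rightarrow> real \<Rightarrow> real \<Rightarrow> (real \<Rightarrow> real \<Rightarrow> real) set" where
  "gap_function_space \<epsilon> \<omega> U1 U2 T1 =
     {u. continuous_on ({0..T1} \<times> {\<epsilon>..\<omega>}) (\<lambda>(T, x). u T x) \<and>
         (\<forall>T\<in>{0..T1}. \<forall>x\<in>{\<epsilon>..\<omega>}.
            simple_gap \<epsilon> \<omega> U1 T \<le> u T x \<and> u T x \<le> simple_gap \<epsilon> \<omega> U2 T)}"

end

theory Submission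
  imports Defs "HOL-Complex_Analysis.Great_Picard"
begin

text \<open>
  The solutions \<open>u\<^sub>0(T, \<cdot>)\<close> form a bounded equicontinuous family, because the kernel is bounded and
  uniformly continuous in \<open>x\<close>. If \<open>T\<^sub>n \<rightarrow> T\<close>, the theorem of Arzela and Ascoli therefore yields
  uniform limit points of \<open>u\<^sub>0(T\<^sub>n, \<cdot>)\<close>; each of them solves the gap equation at \<open>T\<close> and hence
  equals \<open>u\<^sub>0(T, \<cdot>)\<close> by uniqueness. The bounds \<open>\<Delta>\<^sub>1(T) \<le> v \<le> \<Delta>\<^sub>2(T)\<close> survive the limit because,
  by strict monotonicity of the integral \<open>H(T, d)\<close> in the simple gap equation, they are equivalent
  to the closed conditions \<open>U\<^sub>1 H(T, v) \<le> 1\<close> and \<open>v = 0 \<or> U\<^sub>2 H(T, v) \<ge> 1\<close>.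
\<close>

section \<open>Elementary estimates for the hyperbolic tangent\<close>

lemma tanh_ge:
  fixes x :: real
  assumes "x > 0"
  shows "tanh x \<ge> 1 - 1 / x"
proof -
  define e where "e = exp (2 * x)"
  have e: "e \<ge> 1 + 2 * x"
    unfolding e_def by (rule exp_ge_add_one_self)
  have "exp (- 2 * x) = 1 / e"
    by (simp add: e_def exp_minus inverse_eq_divide)
  then have "tanh x = (1 - 1 / e) / (1 + 1 / e)"
    by (simp only: tanh_real_altdef)
  also have "\<dots> = ((e - 1) / e) / ((e + 1) / e)"
    using e assms by (simp add: diff_divide_distrib add_divide_distrib)
  also have "\<dots> = 1 - 2 / (e + 1)"
    using e assms by (simp add: divide_simps)
  finally have "tanh x = 1 - 2 / (e + 1)" .
  \<comment> \<open>The deficit \<open>1 - tanh x\<close> is \<open>2 / (e + 1)\<close>; since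
    \<open>e \<ge> 1 + 2 * x\<close>, it is at most \<open>1 / (1 + x)\<close>.\<close>
  moreover have "2 / (e + 1) \<le> 1 / x"
    using e assms by (simp add: field_simps)
  ultimately show ?thesis by simp
qed

text \<open>Mean value theorem on \<open>[0, x]\<close> with derivative \<open>1 - tanh^2\<close>.
  This one representation gives both \<open>tanh x \<le> x\<close> and the monotonicity of
  \<open>tanh x / x\<close>.\<close>

lemma tanh_mean_value:
  fixes x :: real
  assumes "x > 0"
  obtains w where "0 < w" "w < x" "tanh x = x * (1 - tanh w ^ 2)"
proof -
  have "(tanh has_real_derivative 1 - tanh y ^ 2) (at y)" for y :: real
    using has_field_derivative_tanh[OF _ DERIV_ident, of y UNIV] by simp
  then obtain w where "0 < w" "w < x" "tanh x - tanh 0 = (x - 0) * (1 - tanh w ^ 2)"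
    using MVT2[OF assms, of tanh "\<lambda>x. 1 - tanh x ^ 2"] by blast
  then show ?thesis using that by simp
qed

lemma tanh_le_id:
  fixes x :: real
  assumes "x > 0"
  shows "tanh x \<le> x"
proof -
  obtain w where "tanh x = x * (1 - tanh w ^ 2)"
    using tanh_mean_value[OF assms] by blast
  then show ?thesis using assms by (simp add: mult_left_le)
qed

text \<open>The derivative of \<open>tanh z / z\<close> has the sign of
  \<open>z * (1 - tanh z ^ 2) - tanh z\<close>. Writing \<open>tanh z = z * (1 - tanh w ^ 2)\<close>
  with \<open>0 < w < z\<close> shows that this is negative.\<close>

lemma tanh_over_id_strict_antimono:
  fixes x y :: real
  assumes "0 < x" "x < y"
  shows "tanh y / y < tanh x / x"
proof (rule DERIV_neg_imp_decreasing[OF assms(2)])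
  fix z assume "x \<le> z" "z \<le> y"
  then have z: "z > 0" using assms by simp
  obtain w where w: "0 < w" "w < z" "tanh z = z * (1 - tanh w ^ 2)"
    using tanh_mean_value[OF z] by blast
  have "tanh w ^ 2 < tanh z ^ 2"
    using w(1,2) by (intro power_strict_mono) auto
  then have "(1 - tanh z ^ 2) * z < tanh z"
    using z mult_strict_left_mono[of "1 - tanh z ^ 2" "1 - tanh w ^ 2" z] w(3)
    by (simp only: mult.commute)
  then have "((1 - tanh z ^ 2) * z - tanh z) / (z * z) < 0"
    using z by (simp add: divide_neg_pos)
  moreover have "((\<lambda>x. tanh x / x) has_real_derivative
      ((1 - tanh z ^ 2) * z - tanh z) / (z * z)) (at z)"
    using z by (auto intro!: derivative_eq_intros)
  ultimately show "\<exists>D. ((\<lambda>x. tanh x / x) has_real_derivative D) (at z) \<and> D < 0"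
    by blast
qed

section \<open>Bounds, monotonicity and joint continuity of the thermal factor\<close>

lemma thermal_bounds:
  assumes "T \<ge> 0" "E > 0"
  shows "1 - 2 * T / E \<le> thermal T E" "thermal T E \<le> 1" "0 < thermal T E"
proof -
  show "1 - 2 * T / E \<le> thermal T E"
    using tanh_ge[of "E / (2 * T)"] assms by (auto simp: thermal_def)
  show "thermal T E \<le> 1"
    using less_imp_le[OF tanh_real_lt_1] by (auto simp: thermal_def)
  show "0 < thermal T E"
    using assms by (auto simp: thermal_def)
qed

lemma thermal_strict_antimono:
  assumes "0 \<le> S" "S < T" "E > 0"
  shows "thermal T E < thermal S E"
  using assms tanh_real_lt_1[of "E / (2 * T)"]
  by (auto simp: thermal_def divide_strict_left_mono)

text \<open>For \<open>T > 0\<close> the function of \<open>E\<close> is \<open>1 / (2 * T)\<close>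
  times \<open>tanh y / y\<close> at \<open>y = E / (2 * T)\<close>; for \<open>T = 0\<close> it is
  \<open>1 / E\<close>. Strict decrease of the simple gap integral in the gap rests on this.\<close>

lemma thermal_over_id_strict_antimono:
  assumes "T \<ge> 0" "0 < E" "E < F"
  shows "1 / F * thermal T F < 1 / E * thermal T E"
proof (cases "T = 0")
  case True
  then show ?thesis using assms by (simp add: thermal_def divide_strict_left_mono)
next
  case False
  then have T: "T > 0" using assms by simp
  have "tanh (F / (2 * T)) / (F / (2 * T)) < tanh (E / (2 * T)) / (E / (2 * T))"
    using assms T by (intro tanh_over_id_strict_antimono) (auto simp: divide_strict_right_mono)
  then show ?thesis
    using T assms by (simp add: thermal_def field_simps)
qed

text \<open>The delicate points are those with \<open>T = 0\<close>, where
  \<open>E / (2 * T)\<close> blows up. There the factor is squeezed between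
  \<open>1 - 2 * T / E\<close> and 1, and the lower bound is continuous because
  \<open>E > 0\<close>.\<close>

lemma continuous_on_thermal:
  "continuous_on ({0..} \<times> {0<..}) (\<lambda>(T, E). thermal T E)"
  unfolding continuous_on_def
proof
  fix p :: "real \<times> real" assume "p \<in> {0..} \<times> {0<..}"
  then obtain T E where p: "p = (T, E)" and TE: "T \<ge> 0" "E > 0" by auto
  let ?F = "at (T, E) within {0..} \<times> {0<..}"
  show "((\<lambda>(T, E). thermal T E) \<longlongrightarrow> (case p of (T, E) \<Rightarrow> thermal T E)) (at p within {0..} \<times> {0<..})"
  proof (cases "T = 0")
    case True
    have "((\<lambda>q. 1 - 2 * fst q / snd q) \<longlongrightarrow> 1 - 2 * fst (T, E) / snd (T, E)) ?F"
      using TE by (intro tendsto_intros) auto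
    then have lower: "((\<lambda>q. 1 - 2 * fst q / snd q) \<longlongrightarrow> 1) ?F"
      using True by simp
    have "((\<lambda>q. thermal (fst q) (snd q)) \<longlongrightarrow> 1) ?F"
      by (rule tendsto_sandwich[OF _ _ lower tendsto_const])
         (auto simp: eventually_at_filter intro!: always_eventually thermal_bounds)
    then show ?thesis
      using True p by (simp add: case_prod_unfold thermal_def[of 0])
  next
    case False
    have "continuous_on ({0<..} \<times> {0<..}) (\<lambda>q::real \<times> real. tanh (snd q / (2 * fst q)))"
      by (auto intro!: continuous_intros)
    moreover have "open ({0<..} \<times> {0<..} :: (real \<times> real) set)"
      by (intro open_Times open_greaterThan)
    ultimately have "isCont (\<lambda>q::real \<times> real. tanh (snd q / (2 * fst q))) (T, E)"
      using False TE by (auto simp: continuous_on_eq_continuous_at)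
    then have "((\<lambda>q. tanh (snd q / (2 * fst q))) \<longlongrightarrow> tanh (E / (2 * T))) ?F"
      unfolding continuous_at by (auto intro: tendsto_within_subset[where S = UNIV])
    \<comment> \<open>Near a point of positive temperature the special branch of
      \<open>thermal\<close> at zero is not met.\<close>
    moreover have "\<forall>\<^sub>F q in ?F. tanh (snd q / (2 * fst q)) = thermal (fst q) (snd q)"
    proof -
      have "((\<lambda>q. fst q) \<longlongrightarrow> fst (T, E)) ?F"
        by (intro tendsto_intros)
      from order_tendstoD(1)[OF this, of 0] have "\<forall>\<^sub>F q in ?F. fst q > 0"
        using False TE by simp
      then show ?thesis
        by eventually_elim (simp add: thermal_def)
    qed
    ultimately show ?thesis
      using False p by (simp add: case_prod_unfold thermal_def tendsto_cong)
  qed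
qed

lemma continuous_on_thermal_compose:
  assumes "continuous_on A f" "continuous_on A g"
    and "\<And>x. x \<in> A \<Longrightarrow> f x \<ge> 0" "\<And>x. x \<in> A \<Longrightarrow> g x > 0"
  shows "continuous_on A (\<lambda>x. thermal (f x) (g x))"
  using continuous_on_compose2[OF continuous_on_thermal continuous_on_Pair[OF assms(1,2)]] assms(3,4)
  by auto

lemma tendsto_thermal:
  assumes "(f \<longlongrightarrow> T) F" "(g \<longlongrightarrow> E) F" "T \<ge> 0" "E > 0"
    and "\<And>x. f x \<ge> 0" "\<And>x. g x > 0"
  shows "((\<lambda>x. thermal (f x) (g x)) \<longlongrightarrow> thermal T E) F"
  using continuous_on_tendsto_compose[OF continuous_on_thermal tendsto_Pair[OF assms(1,2)]] assms(3-)
  by auto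

section \<open>The integral of the simple gap equation and the weight of the BCS equation\<close>

lemma energy_square_pos: "0 < (\<xi>::real) \<Longrightarrow> 0 < \<xi>\<^sup>2 + d\<^sup>2"
  by (simp add: add_pos_nonneg)

lemma energy_pos: "0 < (\<xi>::real) \<Longrightarrow> 0 < sqrt (\<xi>\<^sup>2 + d\<^sup>2)"
  by (simp add: energy_square_pos)

text \<open>This is \<open>H(T, d)\<close>. The coupling is left out so that one function serves
  every simple gap equation.\<close>

definition gap_integral :: "real \<Rightarrow> real \<Rightarrow> real \<Rightarrow> real \<Rightarrow> real" where
  "gap_integral \<epsilon> \<omega> T d =
     integral {\<epsilon>..\<omega>} (\<lambda>\<xi>. 1 / sqrt (\<xi>\<^sup>2 + d\<^sup>2) * thermal T (sqrt (\<xi>\<^sup>2 + d\<^sup>2)))"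

text \<open>The part of the BCS integrand that does not involve \<open>x\<close>: all dependence on
  \<open>x\<close> sits in the kernel \<open>U x \<xi>\<close>.\<close>

definition gap_weight :: "real \<Rightarrow> (real \<Rightarrow> real) \<Rightarrow> real \<Rightarrow> real" where
  "gap_weight T v \<xi> = v \<xi> / sqrt (\<xi>\<^sup>2 + (v \<xi>)\<^sup>2) * thermal T (sqrt (\<xi>\<^sup>2 + (v \<xi>)\<^sup>2))"

text \<open>Both factors have modulus at most 1. The bound is the same for all \<open>T\<close> and
  \<open>v\<close>, which serves dominated convergence as well as equicontinuity.\<close>

lemma abs_gap_weight_le_1:
  assumes "T \<ge> 0" "\<xi> > 0"
  shows "\<bar>gap_weight T v \<xi>\<bar> \<le> 1"
proof -
  have "\<bar>v \<xi>\<bar> \<le> sqrt (\<xi>\<^sup>2 + (v \<xi>)\<^sup>2)" by (intro real_le_rsqrt) auto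
  then have "\<bar>v \<xi> / sqrt (\<xi>\<^sup>2 + (v \<xi>)\<^sup>2)\<bar> \<le> 1"
    using energy_pos[OF assms(2), of "v \<xi>"] by (simp add: abs_divide divide_le_eq_1)
  moreover have "\<bar>thermal T (sqrt (\<xi>\<^sup>2 + (v \<xi>)\<^sup>2))\<bar> \<le> 1"
    using thermal_bounds[OF assms(1) energy_pos[OF assms(2), of "v \<xi>"]] by simp
  ultimately show ?thesis
    unfolding gap_weight_def abs_mult by (rule mult_le_one[OF _ abs_ge_zero])
qed

lemma tendsto_gap_weight:
  assumes "T \<longlonglongrightarrow> T0" "\<And>n::nat. T n \<ge> 0" "(\<lambda>n. w n \<xi>) \<longlonglongrightarrow> v \<xi>" "\<xi> > 0"
  shows "(\<lambda>n. gap_weight (T n) (w n) \<xi>) \<longlonglongrightarrow> gap_weight T0 v \<xi>"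
proof -
  have "T0 \<ge> 0" by (rule LIMSEQ_le_const[OF assms(1)]) (use assms(2) in auto)
  then show ?thesis
    unfolding gap_weight_def using assms
    by (intro tendsto_intros tendsto_thermal) (auto simp: energy_square_pos sum_power2_eq_zero_iff)
qed

context
  fixes \<epsilon> \<omega> :: real
  assumes eps: "0 < \<epsilon>" "\<epsilon> < \<omega>"
begin

lemma continuous_on_gap_integrand:
  "T \<ge> 0 \<Longrightarrow>
     continuous_on {\<epsilon>..\<omega>} (\<lambda>\<xi>. 1 / sqrt (\<xi>\<^sup>2 + d\<^sup>2) * thermal T (sqrt (\<xi>\<^sup>2 + d\<^sup>2)))"
  using eps
  by (intro continuous_intros continuous_on_thermal_compose) (auto simp: energy_square_pos sum_power2_eq_zero_iff)

text \<open>The cutoff \<open>\<epsilon> > 0\<close> keeps the energies away from zero, so the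
  integrand is jointly continuous even at \<open>T = 0\<close> and \<open>d = 0\<close>.\<close>

lemma continuous_on_gap_integral:
  "continuous_on ({0..} \<times> UNIV) (\<lambda>(T, d). gap_integral \<epsilon> \<omega> T d)"
proof -
  have "continuous_on (({0..} \<times> UNIV) \<times> cbox \<epsilon> \<omega>)
      (\<lambda>(p, \<xi>). 1 / sqrt (\<xi>\<^sup>2 + (snd p)\<^sup>2) * thermal (fst p) (sqrt (\<xi>\<^sup>2 + (snd p)\<^sup>2)))"
    using eps unfolding case_prod_beta
    by (intro continuous_intros continuous_on_thermal_compose) (auto simp: energy_square_pos sum_power2_eq_zero_iff)
  from integral_continuous_on_param[OF this] show ?thesis
    by (simp add: gap_integral_def case_prod_beta)
qed

lemma gap_integral_strict_antimono:
  assumes "T \<ge> 0" "0 \<le> d" "d < e"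
  shows "gap_integral \<epsilon> \<omega> T e < gap_integral \<epsilon> \<omega> T d"
  unfolding gap_integral_def
proof (rule integral_less_real)
  fix \<xi> assume "\<xi> \<in> {\<epsilon><..<\<omega>}"
  then show "1 / sqrt (\<xi>\<^sup>2 + e\<^sup>2) * thermal T (sqrt (\<xi>\<^sup>2 + e\<^sup>2)) <
             1 / sqrt (\<xi>\<^sup>2 + d\<^sup>2) * thermal T (sqrt (\<xi>\<^sup>2 + d\<^sup>2))"
    using assms eps
    by (intro thermal_over_id_strict_antimono) (auto simp: energy_square_pos power_strict_mono)
qed (use eps assms continuous_on_gap_integrand in auto)

lemma gap_integral_eq_iff:
  assumes "T \<ge> 0" "d \<ge> 0" "e \<ge> 0"
  shows "gap_integral \<epsilon> \<omega> T d = gap_integral \<epsilon> \<omega> T e \<longleftrightarrow> d = e"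
  using gap_integral_strict_antimono[of T d e] gap_integral_strict_antimono[of T e d] assms
  by (cases d e rule: linorder_cases) auto

text \<open>Gap zero is the case that matters for the critical temperature, which solves
  \<open>c * H(T, 0) = 1\<close>.\<close>

lemma gap_integral_zero_strict_antimono:
  assumes "0 \<le> S" "S < T"
  shows "gap_integral \<epsilon> \<omega> T 0 < gap_integral \<epsilon> \<omega> S 0"
  unfolding gap_integral_def
proof (rule integral_less_real)
  fix \<xi> assume "\<xi> \<in> {\<epsilon><..<\<omega>}"
  then show "1 / sqrt (\<xi>\<^sup>2 + 0\<^sup>2) * thermal T (sqrt (\<xi>\<^sup>2 + 0\<^sup>2)) <
             1 / sqrt (\<xi>\<^sup>2 + 0\<^sup>2) * thermal S (sqrt (\<xi>\<^sup>2 + 0\<^sup>2))"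
    using assms eps
    by (intro mult_strict_left_mono thermal_strict_antimono) (auto simp: energy_pos)
next
  show "continuous_on {\<epsilon>..\<omega>} (\<lambda>\<xi>. 1 / sqrt (\<xi>\<^sup>2 + 0\<^sup>2) * thermal T (sqrt (\<xi>\<^sup>2 + 0\<^sup>2)))"
    using assms by (intro continuous_on_gap_integrand) simp
  show "continuous_on {\<epsilon>..\<omega>} (\<lambda>\<xi>. 1 / sqrt (\<xi>\<^sup>2 + 0\<^sup>2) * thermal S (sqrt (\<xi>\<^sup>2 + 0\<^sup>2)))"
    using assms by (intro continuous_on_gap_integrand)
qed (use eps in simp)

lemma gap_integral_le:
  assumes "T \<ge> 0" "\<And>\<xi>. \<xi> \<in> {\<epsilon>..\<omega>} \<Longrightarrow>
      1 / sqrt (\<xi>\<^sup>2 + d\<^sup>2) * thermal T (sqrt (\<xi>\<^sup>2 + d\<^sup>2)) \<le> B"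
  shows "gap_integral \<epsilon> \<omega> T d \<le> B * (\<omega> - \<epsilon>)"
proof -
  have "gap_integral \<epsilon> \<omega> T d \<le> integral {\<epsilon>..\<omega>} (\<lambda>\<xi>. B)"
    unfolding gap_integral_def
    using assms by (intro integral_le integrable_continuous_real continuous_on_gap_integrand) auto
  then show ?thesis using eps by (simp add: mult.commute)
qed

text \<open>The energy is at least \<open>d\<close> and the thermal factor at most 1. This makes
  \<open>c * H(T, d)\<close> small for large \<open>d\<close>, as the intermediate value theorem
  requires.\<close>

lemma gap_integral_le_inverse:
  assumes "T \<ge> 0" "d > 0"
  shows "gap_integral \<epsilon> \<omega> T d \<le> 1 / d * (\<omega> - \<epsilon>)"
proof (rule gap_integral_le)
  fix \<xi> assume "\<xi> \<in> {\<epsilon>..\<omega>}"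
  then have "0 < \<xi>" using eps by simp
  have "1 / sqrt (\<xi>\<^sup>2 + d\<^sup>2) * thermal T (sqrt (\<xi>\<^sup>2 + d\<^sup>2)) \<le> 1 / d * 1"
    using \<open>0 < \<xi>\<close> assms thermal_bounds[OF \<open>T \<ge> 0\<close> energy_pos[OF \<open>0 < \<xi>\<close>, of d]]
    by (intro mult_mono divide_left_mono real_le_rsqrt mult_pos_pos energy_pos) auto
  then show "1 / sqrt (\<xi>\<^sup>2 + d\<^sup>2) * thermal T (sqrt (\<xi>\<^sup>2 + d\<^sup>2)) \<le> 1 / d" by simp
qed fact

text \<open>From \<open>tanh y \<le> y\<close> at \<open>y = \<xi> / (2 * T)\<close>; the
  counterpart of the previous bound for large temperatures.\<close>

lemma gap_integral_zero_le_inverse: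
  assumes "T > 0"
  shows "gap_integral \<epsilon> \<omega> T 0 \<le> 1 / (2 * T) * (\<omega> - \<epsilon>)"
proof (rule gap_integral_le)
  fix \<xi> assume "\<xi> \<in> {\<epsilon>..\<omega>}"
  then have "0 < \<xi>" using eps by simp
  have "tanh (\<xi> / (2 * T)) \<le> \<xi> / (2 * T)"
    using \<open>0 < \<xi>\<close> assms by (intro tanh_le_id) simp
  then show "1 / sqrt (\<xi>\<^sup>2 + 0\<^sup>2) * thermal T (sqrt (\<xi>\<^sup>2 + 0\<^sup>2)) \<le> 1 / (2 * T)"
    using \<open>0 < \<xi>\<close> assms by (simp add: thermal_def field_simps)
qed (use assms in simp)

text \<open>Turns the assumption \<open>c * ln (\<omega> / \<epsilon>) > 1\<close> into
  \<open>c * H(0, 0) > 1\<close>.\<close>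

lemma gap_integral_zero_zero: "gap_integral \<epsilon> \<omega> 0 0 = ln (\<omega> / \<epsilon>)"
proof -
  have "((\<lambda>\<xi>. 1 / \<xi>) has_integral (ln \<omega> - ln \<epsilon>)) {\<epsilon>..\<omega>}"
    using eps
    by (intro fundamental_theorem_of_calculus)
       (auto intro!: derivative_eq_intros simp flip: has_real_derivative_iff_has_vector_derivative)
  moreover have "gap_integral \<epsilon> \<omega> 0 0 = integral {\<epsilon>..\<omega>} (\<lambda>\<xi>. 1 / \<xi>)"
    unfolding gap_integral_def using eps by (intro integral_cong) (auto simp: thermal_def)
  ultimately show ?thesis
    using eps by (simp add: ln_div integral_unique)
qed

section \<open>Critical temperature and simple gap for a single coupling\<close>

context
  fixes c :: real
  assumes c: "0 < c" "c * ln (\<omega> / \<epsilon>) > 1"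
begin

text \<open>The continuous function \<open>c * H(t, 0)\<close> exceeds 1 at \<open>t = 0\<close> and
  falls below 1 later, so it takes the value 1; strict decrease makes the root unique and the
  definite description meaningful.\<close>

lemma crit_temp: "crit_temp \<epsilon> \<omega> c > 0" "c * gap_integral \<epsilon> \<omega> (crit_temp \<epsilon> \<omega> c) 0 = 1"
proof -
  have eq: "integral {\<epsilon>..\<omega>} (\<lambda>\<xi>. 1 / \<xi> * tanh (\<xi> / (2 * t))) = gap_integral \<epsilon> \<omega> t 0"
    if "t > 0" for t
    unfolding gap_integral_def using that eps by (intro integral_cong) (auto simp: thermal_def)
  \<comment> \<open>Chosen so that the bound \<open>c / (2 * b) * (\<omega> - \<epsilon>)\<close>
    equals \<open>1 / 2\<close>.\<close>
  define b where "b = c * (\<omega> - \<epsilon>)"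
  have b: "b > 0" using c eps by (simp add: b_def)
  have "c * gap_integral \<epsilon> \<omega> b 0 \<le> c * (1 / (2 * b) * (\<omega> - \<epsilon>))"
    using c b by (intro mult_left_mono gap_integral_zero_le_inverse) auto
  also have "\<dots> = 1 / 2"
    using c eps by (simp add: b_def)
  finally have "c * gap_integral \<epsilon> \<omega> b 0 \<le> 1" by simp
  moreover have "c * gap_integral \<epsilon> \<omega> 0 0 > 1"
    using c by (simp add: gap_integral_zero_zero)
  moreover have "continuous_on {0..b} (\<lambda>t. c * gap_integral \<epsilon> \<omega> t 0)"
    by (intro continuous_intros
        continuous_on_compose2[OF continuous_on_gap_integral continuous_on_Pair, simplified]) auto
  ultimately obtain t where t: "0 \<le> t" "t \<le> b" "c * gap_integral \<epsilon> \<omega> t 0 = 1"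
    using IVT2'[of "\<lambda>t. c * gap_integral \<epsilon> \<omega> t 0" b 1 0] b by auto
  have "t \<noteq> 0" using t \<open>c * gap_integral \<epsilon> \<omega> 0 0 > 1\<close> by auto
  then have tpos: "t > 0" using t by simp
  have "crit_temp \<epsilon> \<omega> c = t"
    unfolding crit_temp_def
  proof (rule the_equality)
    show "t > 0 \<and> 1 = c * integral {\<epsilon>..\<omega>} (\<lambda>\<xi>. 1 / \<xi> * tanh (\<xi> / (2 * t)))"
      using tpos t eq by simp
    fix s assume s: "s > 0 \<and> 1 = c * integral {\<epsilon>..\<omega>} (\<lambda>\<xi>. 1 / \<xi> * tanh (\<xi> / (2 * s)))"
    then have "c * gap_integral \<epsilon> \<omega> s 0 = c * gap_integral \<epsilon> \<omega> t 0"
      using eq[of s] t(3) by metis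
    then have "gap_integral \<epsilon> \<omega> s 0 = gap_integral \<epsilon> \<omega> t 0" using c by simp
    then show "s = t"
      using gap_integral_zero_strict_antimono[of s t] gap_integral_zero_strict_antimono[of t s] s tpos
      by (cases s t rule: linorder_cases) auto
  qed
  then show "crit_temp \<epsilon> \<omega> c > 0" "c * gap_integral \<epsilon> \<omega> (crit_temp \<epsilon> \<omega> c) 0 = 1"
    using t tpos by auto
qed

text \<open>The same argument in the variable \<open>d\<close>: up to the critical temperature
  \<open>c * H(T, 0)\<close> is at least 1, and \<open>c * H(T, b)\<close> is at most 1 for
  \<open>b = c * (\<omega> - \<epsilon>)\<close>.\<close>

lemma simple_gap_below_crit_temp:
  assumes "0 \<le> T" "T \<le> crit_temp \<epsilon> \<omega> c"
  shows "simple_gap \<epsilon> \<omega> c T \<ge> 0" "c * gap_integral \<epsilon> \<omega> T (simple_gap \<epsilon> \<omega> c T) = 1"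
proof -
  define b where "b = c * (\<omega> - \<epsilon>)"
  have b: "b > 0" using c eps by (simp add: b_def)
  have "c * gap_integral \<epsilon> \<omega> T b \<le> c * (1 / b * (\<omega> - \<epsilon>))"
    using c b assms by (intro mult_left_mono gap_integral_le_inverse) auto
  also have "\<dots> = 1"
    using c eps by (simp add: b_def)
  finally have "c * gap_integral \<epsilon> \<omega> T b \<le> 1" .
  moreover have "c * gap_integral \<epsilon> \<omega> T 0 \<ge> 1"
    using gap_integral_zero_strict_antimono[of T "crit_temp \<epsilon> \<omega> c"] assms crit_temp(2) c
      mult_strict_left_mono[of _ _ c]
    by (cases "T = crit_temp \<epsilon> \<omega> c") fastforce+
  moreover have "continuous_on {0..b} (\<lambda>d. c * gap_integral \<epsilon> \<omega> T d)"
    using assms by (intro continuous_intros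
        continuous_on_compose2[OF continuous_on_gap_integral continuous_on_Pair, simplified]) auto
  ultimately obtain d where d: "0 \<le> d" "d \<le> b" "c * gap_integral \<epsilon> \<omega> T d = 1"
    using IVT2'[of "\<lambda>d. c * gap_integral \<epsilon> \<omega> T d" b 1 0] b by auto
  have "simple_gap \<epsilon> \<omega> c T = (THE d. d \<ge> 0 \<and> 1 = c * gap_integral \<epsilon> \<omega> T d)"
    using assms by (simp add: simple_gap_def gap_integral_def)
  also have "\<dots> = d"
  proof (rule the_equality)
    show "d \<ge> 0 \<and> 1 = c * gap_integral \<epsilon> \<omega> T d" using d by simp
    fix e assume e: "e \<ge> 0 \<and> 1 = c * gap_integral \<epsilon> \<omega> T e"
    then have "c * gap_integral \<epsilon> \<omega> T e = c * gap_integral \<epsilon> \<omega> T d" using d by simp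
    then have "gap_integral \<epsilon> \<omega> T e = gap_integral \<epsilon> \<omega> T d" using c by simp
    then show "e = d" using gap_integral_eq_iff[of T e d] d(1) e assms(1) by blast
  qed
  finally show "simple_gap \<epsilon> \<omega> c T \<ge> 0" "c * gap_integral \<epsilon> \<omega> T (simple_gap \<epsilon> \<omega> c T) = 1"
    using d by auto
qed

lemma simple_gap_above_crit_temp:
  assumes "crit_temp \<epsilon> \<omega> c < T"
  shows "simple_gap \<epsilon> \<omega> c T = 0" "c * gap_integral \<epsilon> \<omega> T 0 < 1"
proof -
  show "simple_gap \<epsilon> \<omega> c T = 0" using assms by (simp add: simple_gap_def)
  have "c * gap_integral \<epsilon> \<omega> T 0 < c * gap_integral \<epsilon> \<omega> (crit_temp \<epsilon> \<omega> c) 0"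
    using assms crit_temp(1) c by (intro mult_strict_left_mono gap_integral_zero_strict_antimono) auto
  then show "c * gap_integral \<epsilon> \<omega> T 0 < 1" using crit_temp(2) by simp
qed

lemma simple_gap_nonneg: "T \<ge> 0 \<Longrightarrow> simple_gap \<epsilon> \<omega> c T \<ge> 0"
  using simple_gap_below_crit_temp(1)[of T] simple_gap_above_crit_temp(1)[of T]
  by (cases "T \<le> crit_temp \<epsilon> \<omega> c") auto

lemma gap_integral_antimono_scaled:
  assumes "T \<ge> 0" "0 \<le> d" "d \<le> e"
  shows "c * gap_integral \<epsilon> \<omega> T e \<le> c * gap_integral \<epsilon> \<omega> T d"
  using gap_integral_strict_antimono[of T d e] assms c by (cases "d = e") auto

lemma gap_integral_strict_antimono_scaled:
  assumes "T \<ge> 0" "0 \<le> d" "d < e"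
  shows "c * gap_integral \<epsilon> \<omega> T e < c * gap_integral \<epsilon> \<omega> T d"
  using gap_integral_strict_antimono[of T d e] assms c by auto

text \<open>Up to the critical temperature, compare \<open>c * H(T, v)\<close> with its value 1 at
  the gap. Above it both sides are true, as the gap is 0 and
  \<open>c * H(T, v) \<le> c * H(T, 0) < 1\<close>.\<close>

lemma simple_gap_le_iff:
  assumes "T \<ge> 0" "v \<ge> 0"
  shows "simple_gap \<epsilon> \<omega> c T \<le> v \<longleftrightarrow> c * gap_integral \<epsilon> \<omega> T v \<le> 1"
proof (cases "T \<le> crit_temp \<epsilon> \<omega> c")
  case True
  note s = simple_gap_below_crit_temp[OF assms(1) True]
  show ?thesis
    using gap_integral_antimono_scaled[OF assms(1) s(1), of v]
      gap_integral_strict_antimono_scaled[OF assms, of "simple_gap \<epsilon> \<omega> c T"] s(2)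
    by linarith
next
  case False
  then show ?thesis
    using gap_integral_antimono_scaled[of T 0 v] simple_gap_above_crit_temp[of T] assms by simp
qed

text \<open>The alternative \<open>v = 0\<close> accounts for temperatures above the critical one,
  where the gap is 0 although \<open>c * H(T, 0) < 1\<close>.\<close>

lemma le_simple_gap_iff:
  assumes "T \<ge> 0" "v \<ge> 0"
  shows "v \<le> simple_gap \<epsilon> \<omega> c T \<longleftrightarrow> v = 0 \<or> c * gap_integral \<epsilon> \<omega> T v \<ge> 1"
proof (cases "T \<le> crit_temp \<epsilon> \<omega> c")
  case True
  note s = simple_gap_below_crit_temp[OF assms(1) True]
  show ?thesis
    using gap_integral_antimono_scaled[OF assms, of "simple_gap \<epsilon> \<omega> c T"]
      gap_integral_strict_antimono_scaled[OF assms(1) s(1), of v] s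
    by linarith
next
  case False
  then show ?thesis
    using gap_integral_antimono_scaled[of T 0 v] simple_gap_above_crit_temp[of T] assms by auto
qed

lemma simple_gap_bounded:
  assumes "T \<ge> 0"
  shows "simple_gap \<epsilon> \<omega> c T \<le> c * (\<omega> - \<epsilon>)"
proof -
  have "c * (\<omega> - \<epsilon>) > 0" using c eps by simp
  then have "c * gap_integral \<epsilon> \<omega> T (c * (\<omega> - \<epsilon>)) \<le> c * (1 / (c * (\<omega> - \<epsilon>)) * (\<omega> - \<epsilon>))"
    using c assms by (intro mult_left_mono gap_integral_le_inverse) auto
  also have "\<dots> = 1" using c eps by simp
  finally show ?thesis using simple_gap_le_iff[OF assms, of "c * (\<omega> - \<epsilon>)"] c eps by simp
qed

text \<open>The inequality is rewritten as \<open>c * H(T, v) \<le> 1\<close>, which passes to the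
  limit by joint continuity of \<open>H\<close>.\<close>

lemma simple_gap_le_limit:
  assumes "T \<longlonglongrightarrow> T0" "\<And>n::nat. T n \<ge> 0" "v \<longlonglongrightarrow> v0"
    and "\<And>n. simple_gap \<epsilon> \<omega> c (T n) \<le> v n"
  shows "simple_gap \<epsilon> \<omega> c T0 \<le> v0"
proof -
  have T0: "T0 \<ge> 0" by (rule LIMSEQ_le_const[OF assms(1)]) (use assms(2) in auto)
  have v: "v n \<ge> 0" for n
    by (rule order_trans[OF simple_gap_nonneg[OF assms(2)] assms(4)])
  have v0: "v0 \<ge> 0" by (rule LIMSEQ_le_const[OF assms(3)]) (use v in auto)
  have "(\<lambda>n. c * gap_integral \<epsilon> \<omega> (T n) (v n)) \<longlonglongrightarrow> c * gap_integral \<epsilon> \<omega> T0 v0"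
    using continuous_on_tendsto_compose[OF continuous_on_gap_integral tendsto_Pair[OF assms(1,3)]]
      assms(2) T0 by (auto intro: tendsto_mult_left)
  then have "c * gap_integral \<epsilon> \<omega> T0 v0 \<le> 1"
    using simple_gap_le_iff[OF assms(2) v] assms(4) by (intro LIMSEQ_le_const2) auto
  then show ?thesis using simple_gap_le_iff[OF T0 v0] by simp
qed

lemma le_simple_gap_limit:
  assumes "T \<longlonglongrightarrow> T0" "\<And>n::nat. T n \<ge> 0" "v \<longlonglongrightarrow> v0"
    and "\<And>n. 0 \<le> v n" "\<And>n. v n \<le> simple_gap \<epsilon> \<omega> c (T n)"
  shows "v0 \<le> simple_gap \<epsilon> \<omega> c T0"
proof (cases "v0 = 0")
  case True
  have "T0 \<ge> 0" by (rule LIMSEQ_le_const[OF assms(1)]) (use assms(2) in auto)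
  then show ?thesis using simple_gap_nonneg True by simp
next
  case False
  have T0: "T0 \<ge> 0" by (rule LIMSEQ_le_const[OF assms(1)]) (use assms(2) in auto)
  have v0: "v0 \<ge> 0" by (rule LIMSEQ_le_const[OF assms(3)]) (use assms(4) in auto)
  have "(\<lambda>n. c * gap_integral \<epsilon> \<omega> (T n) (v n)) \<longlonglongrightarrow> c * gap_integral \<epsilon> \<omega> T0 v0"
    using continuous_on_tendsto_compose[OF continuous_on_gap_integral tendsto_Pair[OF assms(1,3)]]
      assms(2) T0 by (auto intro: tendsto_mult_left)
  \<comment> \<open>A positive limit rules out the alternative \<open>v n = 0\<close> from some
    index on, leaving the closed condition on \<open>H\<close>.\<close>
  moreover have "\<forall>\<^sub>F n in sequentially. v n > 0"
    using assms(3) False v0 by (intro order_tendstoD(1)[of _ v0]) auto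
  then have "\<forall>\<^sub>F n in sequentially. 1 \<le> c * gap_integral \<epsilon> \<omega> (T n) (v n)"
    by eventually_elim (use le_simple_gap_iff[OF assms(2,4)] assms(5) in \<open>metis less_irrefl\<close>)
  ultimately have "1 \<le> c * gap_integral \<epsilon> \<omega> T0 v0"
    by (intro tendsto_lowerbound) auto
  then show ?thesis using le_simple_gap_iff[OF T0 v0] by simp
qed

end

section \<open>Compactness of the solutions of the BCS gap equation\<close>

lemma continuous_on_gap_weight:
  assumes "T \<ge> 0" "continuous_on {\<epsilon>..\<omega>} v"
  shows "continuous_on {\<epsilon>..\<omega>} (gap_weight T v)"
  unfolding gap_weight_def using eps assms
  by (intro continuous_intros continuous_on_thermal_compose) (auto simp: energy_square_pos sum_power2_eq_zero_iff)

context
  fixes U1 U2 :: real and U :: "real \<Rightarrow> real \<Rightarrow> real"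
  assumes U1: "0 < U1" "U1 * ln (\<omega> / \<epsilon>) > 1"
    and U2: "0 < U2" "U2 * ln (\<omega> / \<epsilon>) > 1"
    and U_cont: "continuous_on ({\<epsilon>..\<omega>} \<times> {\<epsilon>..\<omega>}) (\<lambda>(x, \<xi>). U x \<xi>)"
begin

lemma continuous_on_interaction_row:
  assumes "x \<in> {\<epsilon>..\<omega>}"
  shows "continuous_on {\<epsilon>..\<omega>} (U x)"
proof -
  have "continuous_on {\<epsilon>..\<omega>} (\<lambda>\<xi>. (x, \<xi>))"
    by (intro continuous_intros)
  from continuous_on_compose2[OF U_cont this] show ?thesis
    using assms by (simp add: image_subset_iff)
qed

lemma BCS_gap_solution_alt:
  "BCS_gap_solution \<epsilon> \<omega> U1 U2 U T v \<longleftrightarrow>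
     continuous_on {\<epsilon>..\<omega>} v \<and>
     (\<forall>x\<in>{\<epsilon>..\<omega>}. simple_gap \<epsilon> \<omega> U1 T \<le> v x \<and> v x \<le> simple_gap \<epsilon> \<omega> U2 T) \<and>
     (\<forall>x\<in>{\<epsilon>..\<omega>}. v x = integral {\<epsilon>..\<omega>} (\<lambda>\<xi>. U x \<xi> * gap_weight T v \<xi>))"
  unfolding BCS_gap_solution_def gap_weight_def by (simp add: mult.assoc)

lemma BCS_gap_solution_continuous:
  "BCS_gap_solution \<epsilon> \<omega> U1 U2 U T v \<Longrightarrow> continuous_on {\<epsilon>..\<omega>} v"
  unfolding BCS_gap_solution_def by (rule conjunct1)

text \<open>The order bounds pass to the limit by the two preceding limit lemmas, the equation by
  dominated convergence with majorant \<open>\<bar>U x \<xi>\<bar>\<close>. Pointwise convergence is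
  enough once \<open>v\<close> is known to be continuous.\<close>

lemma BCS_gap_solution_limit:
  assumes "T \<longlonglongrightarrow> T0" "\<And>n::nat. T n \<ge> 0"
    and "\<And>n. BCS_gap_solution \<epsilon> \<omega> U1 U2 U (T n) (w n)"
    and "\<And>x. x \<in> {\<epsilon>..\<omega>} \<Longrightarrow> (\<lambda>n. w n x) \<longlonglongrightarrow> v x"
    and "continuous_on {\<epsilon>..\<omega>} v"
  shows "BCS_gap_solution \<epsilon> \<omega> U1 U2 U T0 v"
  unfolding BCS_gap_solution_alt
proof (intro conjI ballI)
  fix x assume x: "x \<in> {\<epsilon>..\<omega>}"
  note w = assms(3)[unfolded BCS_gap_solution_alt]
  have wx: "simple_gap \<epsilon> \<omega> U1 (T n) \<le> w n x" "w n x \<le> simple_gap \<epsilon> \<omega> U2 (T n)" for n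
    using w x by blast+
  show "simple_gap \<epsilon> \<omega> U1 T0 \<le> v x"
    using simple_gap_le_limit[OF U1 assms(1,2) assms(4)[OF x] wx(1)] .
  have "0 \<le> w n x" for n
    by (rule order_trans[OF simple_gap_nonneg[OF U1 assms(2)] wx(1)])
  then show "v x \<le> simple_gap \<epsilon> \<omega> U2 T0"
    using le_simple_gap_limit[OF U2 assms(1,2) assms(4)[OF x] _ wx(2)] by blast
  have "(\<lambda>n. integral {\<epsilon>..\<omega>} (\<lambda>\<xi>. U x \<xi> * gap_weight (T n) (w n) \<xi>))
      \<longlonglongrightarrow> integral {\<epsilon>..\<omega>} (\<lambda>\<xi>. U x \<xi> * gap_weight T0 v \<xi>)"
  proof (rule dominated_convergence(2))
    show "(\<lambda>\<xi>. U x \<xi> * gap_weight (T n) (w n) \<xi>) integrable_on {\<epsilon>..\<omega>}" for n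
      by (intro integrable_continuous_real continuous_on_mult
          continuous_on_interaction_row[OF x] continuous_on_gap_weight assms w[THEN conjunct1])
    show "(\<lambda>\<xi>. \<bar>U x \<xi>\<bar>) integrable_on {\<epsilon>..\<omega>}"
      by (intro integrable_continuous_real continuous_intros continuous_on_interaction_row[OF x])
    show "norm (U x \<xi> * gap_weight (T n) (w n) \<xi>) \<le> \<bar>U x \<xi>\<bar>" if "\<xi> \<in> {\<epsilon>..\<omega>}" for n \<xi>
      using abs_gap_weight_le_1[OF assms(2), of \<xi> n "w n"] that eps
      by (simp add: abs_mult mult_left_le)
    show "(\<lambda>n. U x \<xi> * gap_weight (T n) (w n) \<xi>) \<longlonglongrightarrow> U x \<xi> * gap_weight T0 v \<xi>"
      if "\<xi> \<in> {\<epsilon>..\<omega>}" for \<xi>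
      using that eps assms(1,2,4) by (intro tendsto_mult tendsto_const tendsto_gap_weight) auto
  qed
  moreover have "integral {\<epsilon>..\<omega>} (\<lambda>\<xi>. U x \<xi> * gap_weight (T n) (w n) \<xi>) = w n x" for n
    by (rule sym) (use w x in blast)
  ultimately have "(\<lambda>n. w n x) \<longlonglongrightarrow> integral {\<epsilon>..\<omega>} (\<lambda>\<xi>. U x \<xi> * gap_weight T0 v \<xi>)"
    by (simp only:)
  then show "v x = integral {\<epsilon>..\<omega>} (\<lambda>\<xi>. U x \<xi> * gap_weight T0 v \<xi>)"
    by (rule LIMSEQ_unique[OF assms(4)[OF x]])
qed (fact assms(5))

text \<open>Subtracting the equations at \<open>x\<close> and \<open>y\<close> leaves
  \<open>U x \<xi> - U y \<xi>\<close> times a weight of modulus at most 1. Uniform continuity of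
  \<open>U\<close> then gives a \<open>d\<close> that depends on \<open>e\<close> but not on
  \<open>T\<close> or \<open>v\<close>.\<close>

lemma BCS_gap_solutions_equicontinuous:
  assumes "e > 0"
  shows "\<exists>d>0. \<forall>T\<ge>0. \<forall>v x y. BCS_gap_solution \<epsilon> \<omega> U1 U2 U T v \<longrightarrow>
           x \<in> {\<epsilon>..\<omega>} \<longrightarrow> y \<in> {\<epsilon>..\<omega>} \<longrightarrow> \<bar>x - y\<bar> < d \<longrightarrow> \<bar>v x - v y\<bar> < e"
proof -
  \<comment> \<open>Integrating \<open>r\<close> over the interval gives \<open>e / 2\<close>, which
    leaves room for a strict inequality.\<close>
  define r where "r = e / (2 * (\<omega> - \<epsilon>))"
  have r: "r > 0" using assms eps by (simp add: r_def)
  have "uniformly_continuous_on ({\<epsilon>..\<omega>} \<times> {\<epsilon>..\<omega>}) (\<lambda>(x, \<xi>). U x \<xi>)"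
    by (intro compact_uniformly_continuous[OF U_cont] compact_Times) auto
  then obtain d where d: "d > 0" "\<And>p q. p \<in> {\<epsilon>..\<omega>} \<times> {\<epsilon>..\<omega>} \<Longrightarrow> q \<in> {\<epsilon>..\<omega>} \<times> {\<epsilon>..\<omega>} \<Longrightarrow>
      dist q p < d \<Longrightarrow> dist (case q of (x, \<xi>) \<Rightarrow> U x \<xi>) (case p of (x, \<xi>) \<Rightarrow> U x \<xi>) < r"
    unfolding uniformly_continuous_on_def using r by metis
  have close: "\<bar>U x \<xi> - U y \<xi>\<bar> < r"
    if "x \<in> {\<epsilon>..\<omega>}" "y \<in> {\<epsilon>..\<omega>}" "\<xi> \<in> {\<epsilon>..\<omega>}" "\<bar>x - y\<bar> < d" for x y \<xi>
    using d(2)[of "(y, \<xi>)" "(x, \<xi>)"] that by (simp add: dist_Pair_Pair dist_real_def)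
  show ?thesis
  proof (intro exI[of _ d] conjI allI impI d(1))
    fix T v x y
    assume T: "(T::real) \<ge> 0" and sol: "BCS_gap_solution \<epsilon> \<omega> U1 U2 U T v"
      and x: "x \<in> {\<epsilon>..\<omega>}" and y: "y \<in> {\<epsilon>..\<omega>}" and xy: "\<bar>x - y\<bar> < d"
    note v = sol[unfolded BCS_gap_solution_alt]
    have int: "(\<lambda>\<xi>. U z \<xi> * gap_weight T v \<xi>) integrable_on {\<epsilon>..\<omega>}" if "z \<in> {\<epsilon>..\<omega>}" for z
      by (intro integrable_continuous_real continuous_on_mult
          continuous_on_interaction_row[OF that] continuous_on_gap_weight T v[THEN conjunct1])
    have v_eq: "v z = integral {\<epsilon>..\<omega>} (\<lambda>\<xi>. U z \<xi> * gap_weight T v \<xi>)" if "z \<in> {\<epsilon>..\<omega>}" for z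
      using v that by blast
    have "v x - v y = integral {\<epsilon>..\<omega>} (\<lambda>\<xi>. U x \<xi> * gap_weight T v \<xi> - U y \<xi> * gap_weight T v \<xi>)"
      unfolding integral_diff[OF int[OF x] int[OF y]] by (intro arg_cong2[of _ _ _ _ "(-)"] v_eq x y)
    also have "\<bar>\<dots>\<bar> \<le> integral {\<epsilon>..\<omega>} (\<lambda>\<xi>. r)"
      unfolding real_norm_def[symmetric]
    proof (rule integral_norm_bound_integral)
      fix \<xi> assume xi: "\<xi> \<in> {\<epsilon>..\<omega>}"
      have "\<bar>U x \<xi> - U y \<xi>\<bar> * \<bar>gap_weight T v \<xi>\<bar> \<le> r * 1"
        using close[OF x y xi xy] abs_gap_weight_le_1[OF T, of \<xi> v] xi eps by (intro mult_mono) auto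
      then show "norm (U x \<xi> * gap_weight T v \<xi> - U y \<xi> * gap_weight T v \<xi>) \<le> r"
        by (simp add: abs_mult flip: left_diff_distrib)
    qed (auto intro!: integrable_diff int x y)
    also have "\<dots> = e / 2" using eps by (simp add: r_def field_simps)
    finally show "\<bar>v x - v y\<bar> < e" using assms by simp
  qed
qed

text \<open>Arzela-Ascoli applies with the common bound \<open>U2 * (\<omega> - \<epsilon>)\<close>;
  the uniform limit is continuous and so solves the equation at \<open>T0\<close>.\<close>

lemma BCS_gap_solutions_subsequence:
  assumes "T \<longlonglongrightarrow> T0" "\<And>n::nat. T n \<ge> 0"
    and "\<And>n. BCS_gap_solution \<epsilon> \<omega> U1 U2 U (T n) (w n)"
  obtains v k where "BCS_gap_solution \<epsilon> \<omega> U1 U2 U T0 v" "strict_mono (k :: nat \<Rightarrow> nat)"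
    "uniform_limit {\<epsilon>..\<omega>} (\<lambda>n. w (k n)) v sequentially"
proof -
  have bnd: "norm (w n x) \<le> U2 * (\<omega> - \<epsilon>)" if "x \<in> {\<epsilon>..\<omega>}" for n x
  proof -
    have "simple_gap \<epsilon> \<omega> U1 (T n) \<le> w n x" "w n x \<le> simple_gap \<epsilon> \<omega> U2 (T n)"
      using assms(3) that unfolding BCS_gap_solution_def by blast+
    then show ?thesis
      using simple_gap_nonneg[OF U1 assms(2), of n] simple_gap_bounded[OF U2 assms(2), of n] by simp
  qed
  have equi: "\<exists>d. 0 < d \<and> (\<forall>n y. y \<in> {\<epsilon>..\<omega>} \<and> norm (x - y) < d \<longrightarrow> norm (w n x - w n y) < e)"
    if x: "x \<in> {\<epsilon>..\<omega>}" and "0 < e" for x e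
  proof -
    obtain d where "d > 0" "\<forall>T\<ge>0. \<forall>v x y. BCS_gap_solution \<epsilon> \<omega> U1 U2 U T v \<longrightarrow>
           x \<in> {\<epsilon>..\<omega>} \<longrightarrow> y \<in> {\<epsilon>..\<omega>} \<longrightarrow> \<bar>x - y\<bar> < d \<longrightarrow> \<bar>v x - v y\<bar> < e"
      using BCS_gap_solutions_equicontinuous[OF \<open>0 < e\<close>] by blast
    then show ?thesis
      unfolding real_norm_def using x assms(2,3) by blast
  qed
  obtain v k where v: "continuous_on {\<epsilon>..\<omega>} v" and k: "strict_mono (k :: nat \<Rightarrow> nat)"
    and lim: "\<And>e. 0 < e \<Longrightarrow> \<exists>N. \<forall>n x. n \<ge> N \<and> x \<in> {\<epsilon>..\<omega>} \<longrightarrow> norm (w (k n) x - v x) < e"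
    using Arzela_Ascoli[OF compact_Icc bnd equi] by blast
  have unif: "uniform_limit {\<epsilon>..\<omega>} (\<lambda>n. w (k n)) v sequentially"
    unfolding uniform_limit_sequentially_iff dist_norm using lim by blast
  have "BCS_gap_solution \<epsilon> \<omega> U1 U2 U T0 v"
  proof (rule BCS_gap_solution_limit)
    show "(\<lambda>n. T (k n)) \<longlonglongrightarrow> T0"
      using LIMSEQ_subseq_LIMSEQ[OF assms(1) k] by (simp add: o_def)
    show "(\<lambda>n. w (k n) x) \<longlonglongrightarrow> v x" if "x \<in> {\<epsilon>..\<omega>}" for x
      using tendsto_uniform_limitI[OF unif that] .
  qed (use assms v in auto)
  then show ?thesis using that k unif by blast
qed

text \<open>If continuity failed along a sequence, some subsequence would keep a fixed distance from
  the expected limit. A further subsequence converges to a solution at \<open>T0\<close>, which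
  uniqueness identifies with \<open>u T0\<close>.\<close>

lemma continuous_on_unique_gap_function:
  assumes "S \<subseteq> {0..}"
    and sol: "\<And>T. T \<in> S \<Longrightarrow> BCS_gap_solution \<epsilon> \<omega> U1 U2 U T (u T)"
    and unique: "\<And>T v x. T \<in> S \<Longrightarrow> BCS_gap_solution \<epsilon> \<omega> U1 U2 U T v \<Longrightarrow> x \<in> {\<epsilon>..\<omega>} \<Longrightarrow>
      v x = u T x"
  shows "continuous_on (S \<times> {\<epsilon>..\<omega>}) (\<lambda>(T, x). u T x)"
proof (rule continuous_on_sequentiallyI)
  fix p :: "nat \<Rightarrow> real \<times> real" and q
  assume p: "\<forall>n. p n \<in> S \<times> {\<epsilon>..\<omega>}" and q: "q \<in> S \<times> {\<epsilon>..\<omega>}" and pq: "p \<longlonglongrightarrow> q"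
  obtain T0 x0 where q_eq: "q = (T0, x0)" by (cases q)
  have T0: "T0 \<in> S" "x0 \<in> {\<epsilon>..\<omega>}" using q q_eq by auto
  define f where "f n = u (fst (p n)) (snd (p n))" for n
  have "f \<longlonglongrightarrow> u T0 x0"
  proof (rule ccontr)
    assume "\<not> f \<longlonglongrightarrow> u T0 x0"
    then obtain e where "e > 0" and "infinite {n. \<not> dist (f n) (u T0 x0) < e}"
      by (auto simp: tendsto_iff not_eventually INFM_iff_infinite cofinite_eq_sequentially[symmetric])
    then obtain s :: "nat \<Rightarrow> nat" where s: "strict_mono s" "\<And>n. \<not> dist (f (s n)) (u T0 x0) < e"
      using infinite_enumerate by (metis (mono_tags, lifting) mem_Collect_eq)
    have ps: "(\<lambda>n. p (s n)) \<longlonglongrightarrow> q"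
      using LIMSEQ_subseq_LIMSEQ[OF pq s(1)] by (simp add: o_def)
    have "(\<lambda>n. fst (p (s n))) \<longlonglongrightarrow> T0"
      using tendsto_fst[OF ps] q_eq by simp
    moreover have "fst (p (s n)) \<in> S" "snd (p (s n)) \<in> {\<epsilon>..\<omega>}" for n
      using p by (auto simp: mem_Times_iff)
    ultimately obtain v k where v: "BCS_gap_solution \<epsilon> \<omega> U1 U2 U T0 v"
      and k: "strict_mono (k :: nat \<Rightarrow> nat)"
      and unif: "uniform_limit {\<epsilon>..\<omega>} (\<lambda>n. u (fst (p (s (k n))))) v sequentially"
      using BCS_gap_solutions_subsequence[of "\<lambda>n. fst (p (s n))" T0 "\<lambda>n. u (fst (p (s n)))"]
        sol assms(1) by (metis atLeast_iff subsetD)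
    have psk: "(\<lambda>n. p (s (k n))) \<longlonglongrightarrow> q"
      using LIMSEQ_subseq_LIMSEQ[OF ps k] by (simp add: o_def)
    have "(\<lambda>n. snd (p (s (k n)))) \<longlonglongrightarrow> x0"
      using tendsto_snd[OF psk] q_eq by simp
    then have "(\<lambda>n. v (snd (p (s (k n))))) \<longlonglongrightarrow> v x0"
      using v p T0 by (intro continuous_on_tendsto_compose[of "{\<epsilon>..\<omega>}" v])
        (auto dest: BCS_gap_solution_continuous simp: mem_Times_iff)
    \<comment> \<open>The evaluation point moves with \<open>n\<close>, so uniform convergence on
      the whole interval is used; continuity of \<open>v\<close> takes care of the remaining
      term.\<close>
    moreover have "(\<lambda>n. f (s (k n)) - v (snd (p (s (k n))))) \<longlonglongrightarrow> 0"
    proof (rule metric_LIMSEQ_I)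
      fix r :: real assume "r > 0"
      then obtain N where "\<forall>n\<ge>N. \<forall>x\<in>{\<epsilon>..\<omega>}. dist (u (fst (p (s (k n)))) x) (v x) < r"
        using unif unfolding uniform_limit_sequentially_iff by blast
      then show "\<exists>N. \<forall>n\<ge>N. dist (f (s (k n)) - v (snd (p (s (k n))))) 0 < r"
        using p unfolding f_def dist_norm by (metis diff_zero mem_Times_iff)
    qed
    ultimately have "(\<lambda>n. v (snd (p (s (k n)))) + (f (s (k n)) - v (snd (p (s (k n))))))
        \<longlonglongrightarrow> v x0 + 0"
      by (rule tendsto_add)
    then have "(\<lambda>n. f (s (k n))) \<longlonglongrightarrow> u T0 x0"
      using unique[OF T0(1) v T0(2)] by simp
    then show False
      using s(2) \<open>e > 0\<close> by (auto dest: tendstoD)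
  qed
  then show "(\<lambda>n. case p n of (T, x) \<Rightarrow> u T x) \<longlonglongrightarrow> (case q of (T, x) \<Rightarrow> u T x)"
    by (simp add: f_def[abs_def] q_eq case_prod_beta)
qed

end

end

theorem theorem14:
  fixes U0 U1 U2 \<epsilon> \<omega> T1 :: real
    and U u0 :: "real \<Rightarrow> real \<Rightarrow> real"
  assumes "0 < U0" and "U0 < U1" and "U1 < U2"
    and "0 < \<epsilon>" and "\<epsilon> < \<omega>"
    and "U0 * ln (\<omega> / \<epsilon>) > 1"
    and "continuous_on ({\<epsilon>..\<omega>} \<times> {\<epsilon>..\<omega>}) (\<lambda>(x, \<xi>). U x \<xi>)"
    and "\<forall>x\<in>{\<epsilon>..\<omega>}. \<forall>\<xi>\<in>{\<epsilon>..\<omega>}. U1 \<le> U x \<xi> \<and> U x \<xi> \<le> U2"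
    and "0 < T1"
    and "T1 < simple_gap_inv \<epsilon> \<omega> U0 (simple_gap \<epsilon> \<omega> U0 0 / 2)"
    and "simple_gap \<epsilon> \<omega> U0 0 / (4 * simple_gap_inv \<epsilon> \<omega> U2 (simple_gap \<epsilon> \<omega> U0 T1))
           * tanh (simple_gap \<epsilon> \<omega> U0 0 / (4 * simple_gap_inv \<epsilon> \<omega> U2 (simple_gap \<epsilon> \<omega> U0 T1)))
         > 1 / 2 * (1 + 4 * \<omega>\<^sup>2 / (simple_gap \<epsilon> \<omega> U0 0)\<^sup>2)"
    and "\<forall>T\<in>{0..T1}. BCS_gap_solution \<epsilon> \<omega> U1 U2 U T (u0 T) \<and>
           (\<forall>v. BCS_gap_solution \<epsilon> \<omega> U1 U2 U T v \<longrightarrow> (\<forall>x\<in>{\<epsilon>..\<omega>}. v x = u0 T x))"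
  shows "u0 \<in> gap_function_space \<epsilon> \<omega> U1 U2 T1 \<and>
         continuous_on ({0..T1} \<times> {\<epsilon>..\<omega>}) (\<lambda>(T, x). u0 T x)"
proof -
  have ln_pos: "ln (\<omega> / \<epsilon>) > 0"
    using assms(4,5) by simp
  \<comment> \<open>The smallness condition on \<open>\<epsilon>\<close> is stated for
    \<open>U0\<close> and carries over to larger couplings because the logarithm is
    positive.\<close>
  have U1: "0 < U1" "U1 * ln (\<omega> / \<epsilon>) > 1"
    using assms(1,2,6) mult_strict_right_mono[OF assms(2) ln_pos] by auto
  have U2: "0 < U2" "U2 * ln (\<omega> / \<epsilon>) > 1"
    using U1 assms(3) mult_strict_right_mono[OF assms(3) ln_pos] by auto
  have "continuous_on ({0..T1} \<times> {\<epsilon>..\<omega>}) (\<lambda>(T, x). u0 T x)"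
    using assms(12) by (intro continuous_on_unique_gap_function[OF assms(4,5) U1 U2 assms(7)]) auto
  \<comment> \<open>The bounds required for membership are already part of
    \<open>BCS_gap_solution\<close>.\<close>
  then show ?thesis
    using assms(12) unfolding gap_function_space_def BCS_gap_solution_def by blast
qed

end
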